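(* Let $P$ be a $4$-dimensional reflexive polytope with $\delta$-vector $(1,\delta_1,\delta_2,\delta_1,1)$. Then $P$ is real if and only if either (i) $\delta_1=76$ and $\delta_2=230$, or (ii) $5\delta_2>14\delta_1+86$, $10\delta_1\leq 3\delta_2+70$, and $17(\delta_1+4\delta_2-15)^2\leq(17\delta_1+49)^2+(17\delta_2-94)^2$.
   Context: A $d$-dimensional lattice polytope is a full-dimensional convex polytope $P\subset\mathbb{Z}^d\otimes_{\mathbb{Z}}\mathbb{Q}$ with vertices in $\mathbb{Z}^d$. It is reflexive if its dual $P^*:=\{u\in\mathbb{Z}^d\otimes_{\mathbb{Z}}\mathbb{Q}\mid\langle u,v\rangle\geq -1\text{ for all }v\in P\}$ is also a lattice polytope. The Ehrhart polynomial $L_P$ is the degree-$d$ polynomial with $L_P(m)=|mP\cap\mathbb{Z}^d|$ for all integers $m\geq 0$, regarded as a polynomial over $\mathbb{C}$. The $\delta$-vector $(\delta_0,\ldots,\delta_d)$ of $P$ is defined by $\sum_{m\geq 0}L_P(m)t^m=\frac{\delta_0+\delta_1t+\cdots+\delta_dt^d}{(1-t)^{d+1}}$; for reflexive $P$ it is palindromic with $\delta_0=1$. $P$ is real if every root $z\in\mathbb{C}$ of $L_P$ satisfies $\operatorname{Im}(z)=0$ (for a $4$-dimensional reflexive polytope this means the roots are $\{-1/2\pm a_1,-1/2\pm a_2\}$ with $a_1,a_2\in\mathbb{R}$). *)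

theory Defs
  imports "HOL-Analysis.Analysis" "HOL-Computational_Algebra.Computational_Algebra"
begin

definition integer_lattice :: "(real ^ 'n) set" where
  "integer_lattice = {v. \<forall>i. v $ i \<in> \<int>}"

text \<open>Polytopes live in the real vector space spanned by the lattice, since the library's
  convex geometry is over the reals. A lattice polytope is the convex hull of its (finitely many)
  vertices, so it is determined by the same data over the rationals, with the same lattice
  points in its dilates; likewise the condition that its dual is a lattice polytope is unchanged.\<close>

definition lattice_polytope :: "(real ^ 'n) set \<Rightarrow> bool" where
  "lattice_polytope P \<longleftrightarrow>
     polytope P \<and> aff_dim P = int CARD('n) \<and>
     (\<forall>v. v extreme_point_of P \<longrightarrow> v \<in> integer_lattice)"

definition dual_polytope :: "(real ^ 'n) set \<Rightarrow> (real ^ 'n) set" where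
  "dual_polytope P = {u. \<forall>v\<in>P. u \<bullet> v \<ge> - 1}"

text \<open>If the origin is not an interior point of \<open>P\<close>, then the dual is unbounded, hence not a
  polytope; so reflexivity forces the origin into the interior.\<close>

definition reflexive_polytope :: "(real ^ 'n) set \<Rightarrow> bool" where
  "reflexive_polytope P \<longleftrightarrow> lattice_polytope P \<and> lattice_polytope (dual_polytope P)"

definition lattice_count :: "(real ^ 'n) set \<Rightarrow> nat \<Rightarrow> nat" where
  "lattice_count P m = card ((\<lambda>x. real m *\<^sub>R x) ` P \<inter> integer_lattice)"

definition ehrhart_poly :: "(real ^ 'n) set \<Rightarrow> complex poly" where
  "ehrhart_poly P =
     (THE L. degree L = CARD('n) \<and> (\<forall>m::nat. poly L (of_nat m) = of_nat (lattice_count P m)))"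

text \<open>The list \<open>\<delta> = [\<delta>\<^sub>0, \<dots>, \<delta>\<^sub>d]\<close> is the \<open>\<delta>\<close>-vector of \<open>P\<close>. The coefficient of \<open>t\<^sup>m\<close> in the
  Ehrhart series is the value of the Ehrhart polynomial at \<open>m\<close>, written here as the lattice point
  count that it equals by definition; the quotient is one of formal power series, where
  \<open>1 - t\<close> is a unit.\<close>

definition has_delta_vector :: "(real ^ 'n) set \<Rightarrow> real list \<Rightarrow> bool" where
  "has_delta_vector P \<delta> \<longleftrightarrow>
     length \<delta> = CARD('n) + 1 \<and>
     Abs_fps (\<lambda>m. real (lattice_count P m)) =
       fps_of_poly (Poly \<delta>) / (1 - fps_X) ^ (CARD('n) + 1)"

definition real_polytope :: "(real ^ 'n) set \<Rightarrow> bool" where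
  "real_polytope P \<longleftrightarrow> (\<forall>z. poly (ehrhart_poly P) z = 0 \<longrightarrow> Im z = 0)"

end

theory Submission
  imports Defs
begin

text \<open>In the variable \<open>u = (z + 1/2)\<^sup>2\<close> the Ehrhart polynomial with palindromic
  \<open>\<delta>\<close>-vector is the quadratic \<open>(A u\<^sup>2 + B u + C) / 24\<close>, where \<open>A = 2 + 2 \<delta>\<^sub>1 + \<delta>\<^sub>2\<close>,
  \<open>B = 43 + 7 \<delta>\<^sub>1 - 5 \<delta>\<^sub>2 / 2\<close> and \<open>C = (210 - 30 \<delta>\<^sub>1 + 9 \<delta>\<^sub>2) / 16\<close>. All its roots \<open>z\<close> are real iff
  both roots \<open>u\<close> are real and nonnegative. Since \<open>P\<close> contains a ball, its lattice point count
  grows like \<open>m\<^sup>4\<close>, so \<open>A > 0\<close>, and the condition becomes \<open>B \<le> 0\<close>, \<open>C \<ge> 0\<close>, \<open>4AC \<le> B\<^sup>2\<close>.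
  The boundary case \<open>B = 0\<close> forces \<open>C = 0\<close>, which is the exceptional pair (76, 230).\<close>

section \<open>Lattice points in dilates of a polytope\<close>

lemma finite_bounded_integer_lattice:
  fixes S :: "(real ^ 'n) set"
  assumes "bounded S"
  shows "finite (S \<inter> integer_lattice)"
proof -
  obtain K where K: "\<And>x. x \<in> S \<Longrightarrow> norm x \<le> K"
    using assms by (auto simp: bounded_iff)
  let ?F = "PiE (UNIV :: 'n set) (\<lambda>_. {-\<lceil>K\<rceil>..\<lceil>K\<rceil>})"
  have "S \<inter> integer_lattice \<subseteq> (\<lambda>f. \<chi> i. of_int (f i)) ` ?F"
  proof
    fix x assume x: "x \<in> S \<inter> integer_lattice"
    have "\<lfloor>x $ i\<rfloor> \<in> {-\<lceil>K\<rceil>..\<lceil>K\<rceil>}" for i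
    proof -
      have "\<bar>x $ i\<bar> \<le> K"
        using component_le_norm_cart[of x i] K x by fastforce
      then show ?thesis
        by simp linarith
    qed
    moreover have "x = (\<chi> i. of_int \<lfloor>x $ i\<rfloor>)"
      using x by (simp add: vec_eq_iff integer_lattice_def)
    ultimately show "x \<in> (\<lambda>f. \<chi> i. of_int (f i)) ` ?F"
      by (intro image_eqI[where x = "\<lambda>i. \<lfloor>x $ i\<rfloor>"]) auto
  qed
  moreover have "finite ?F"
    by (intro finite_PiE) auto
  ultimately show ?thesis
    using finite_surj by blast
qed

text \<open>A full-dimensional polytope contains a ball, and its dilates contain integer cubes of
  proportional side. Passing to multiples of a fixed \<open>k\<close> absorbs the constant of
  proportionality.\<close>

lemma lattice_count_lower_bound:
  fixes P :: "(real ^ 'n) set"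
  assumes "lattice_polytope P"
  obtains k :: nat where "\<And>n. n ^ CARD('n) \<le> lattice_count P (k * n)"
proof -
  have P: "polytope P" "aff_dim P = int DIM(real ^ 'n)"
    using assms by (auto simp: lattice_polytope_def)
  have "P \<noteq> {}"
    using P by auto
  then have "interior P \<noteq> {}"
    using P interior_rel_interior rel_interior_eq_empty polytope_imp_convex by metis
  then obtain a e where e: "e > 0" "ball a e \<subseteq> P"
    by (auto simp: mem_interior)
  obtain k :: nat where k: "CARD('n) / e < k"
    using reals_Archimedean2 by blast
  have "n ^ CARD('n) \<le> lattice_count P (k * n)" for n
  proof (cases "n = 0")
    case False
    define m where "m = k * n"
    have "0 < CARD('n) / e"
      using e by simp
    then have "k > 0"
      using k by linarith
    then have m: "real m > 0"
      using False by (simp add: m_def)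
    \<comment> \<open>A cube of lattice points next to the dilated centre. Rounding down loses less
      than 1, so with \<open>f i\<close> in \<open>{1..n}\<close> each coordinate of
      \<open>w f - m *\<^sub>R a\<close> lies in (0, n]. Its l1 norm is at most
      \<open>CARD('n) * n\<close>, below \<open>m * e\<close> by the choice of
      \<open>k\<close>.\<close>
    define w :: "('n \<Rightarrow> nat) \<Rightarrow> real ^ 'n" where
      "w f = (\<chi> i. of_int \<lfloor>m * a $ i\<rfloor> + real (f i))" for f
    let ?F = "PiE (UNIV :: 'n set) (\<lambda>_. {1..n})"
    let ?S = "(\<lambda>x. real m *\<^sub>R x) ` P \<inter> integer_lattice"
    have inj: "inj_on w ?F"
      by (rule inj_onI) (auto simp: w_def vec_eq_iff fun_eq_iff)
    have "w f \<in> ?S" if f: "f \<in> ?F" for f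
    proof -
      have "\<bar>(w f - m *\<^sub>R a) $ i\<bar> \<le> n" for i
      proof -
        have "f i \<in> {1..n}"
          using f by auto
        then have "1 \<le> real (f i)" "real (f i) \<le> n"
          by auto
        then show ?thesis
          by (simp add: w_def) linarith
      qed
      then have "norm (w f - m *\<^sub>R a) \<le> (\<Sum>i\<in>(UNIV::'n set). real n)"
        using norm_le_l1_cart[of "w f - m *\<^sub>R a"] by (meson order_trans sum_mono)
      also have "\<dots> < m * e"
        using k e False by (simp add: m_def field_simps)
      finally have "norm (w f - m *\<^sub>R a) < m * e" .
      moreover have "w f - m *\<^sub>R a = m *\<^sub>R (w f /\<^sub>R m - a)"
        using m by (simp add: algebra_simps)
      ultimately have "norm (w f /\<^sub>R m - a) < e"
        using m by (metis norm_scaleR abs_of_nat mult_less_cancel_left_pos)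
      then have "w f /\<^sub>R m \<in> P"
        using e by (auto simp: dist_norm norm_minus_commute subset_iff)
      moreover have "w f = m *\<^sub>R (w f /\<^sub>R m)"
        using m by simp
      moreover have "w f \<in> integer_lattice"
        by (simp add: integer_lattice_def w_def)
      ultimately show ?thesis
        by blast
    qed
    then have "w ` ?F \<subseteq> ?S"
      by blast
    \<comment> \<open>\<open>card\<close> is 0 on infinite sets, so the injection bounds
      \<open>card ?S\<close> from below only once \<open>?S\<close> is finite.\<close>
    moreover have "finite ?S"
      using P polytope_imp_bounded bounded_scaling finite_bounded_integer_lattice by blast
    ultimately have "card ?F \<le> card ?S"
      using card_inj_on_le[OF inj] by blast
    then show ?thesis
      by (simp add: card_PiE lattice_count_def m_def)
  qed (simp add: power_0_left)
  then show ?thesis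
    using that by blast
qed

section \<open>The Ehrhart polynomial from the \<delta>-vector\<close>

lemma ehrhart_poly_eqI:
  fixes P :: "(real ^ 'n) set"
  assumes "degree L = CARD('n)"
    and "\<And>m. poly L (of_nat m) = of_nat (lattice_count P m)"
  shows "ehrhart_poly P = L"
  unfolding ehrhart_poly_def
proof (rule the_equality)
  fix M :: "complex poly"
  assume M: "degree M = CARD('n) \<and> (\<forall>m. poly M (of_nat m) = of_nat (lattice_count P m))"
  show "M = L"
  proof (rule ccontr)
    assume "M \<noteq> L"
    then have "finite {z. poly (M - L) z = 0}"
      by (intro poly_roots_finite) simp
    \<comment> \<open>A nonzero polynomial cannot vanish at every natural number.\<close>
    moreover have "range of_nat \<subseteq> {z. poly (M - L) z = 0}"
      using M assms by auto
    ultimately have "finite (range (of_nat :: nat \<Rightarrow> complex))"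
      by (rule rev_finite_subset)
    then show False
      using range_inj_infinite[OF inj_of_nat] by blast
  qed
qed (use assms in auto)

lemma inverse_one_minus_fps_X_power_Suc:
  "inverse ((1 - fps_X) ^ Suc d) =
     (Abs_fps (\<lambda>m. of_nat ((m + d) choose d)) :: 'a :: field_char_0 fps)"
proof -
  have "(d + m) choose m = (m + d) choose d" for m
    using binomial_symmetric[of m "d + m"] by (simp add: add.commute)
  then show ?thesis
    using one_minus_const_fps_X_neg_power'[of "Suc d" "1 :: 'a"] by simp
qed

lemma lattice_count_delta:
  fixes P :: "(real ^ 'n) set"
  assumes "has_delta_vector P \<delta>"
  shows "real (lattice_count P m) =
    (\<Sum>i\<le>CARD('n). \<delta> ! i * real ((m + CARD('n) - i) choose CARD('n)))"
proof -
  let ?d = "CARD('n)"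
  have len: "length \<delta> = Suc ?d"
    using assms by (simp add: has_delta_vector_def)
  have "Abs_fps (\<lambda>m. real (lattice_count P m)) =
      fps_of_poly (Poly \<delta>) / (1 - fps_X) ^ Suc ?d"
    using assms by (simp add: has_delta_vector_def)
  also have "\<dots> = fps_of_poly (Poly \<delta>) * inverse ((1 - fps_X) ^ Suc ?d)"
    by (rule fps_divide_unit) simp
  also have "\<dots> = fps_of_poly (Poly \<delta>) * Abs_fps (\<lambda>m. real ((m + ?d) choose ?d))"
    by (subst inverse_one_minus_fps_X_power_Suc) simp
  finally have "real (lattice_count P m) =
      (fps_of_poly (Poly \<delta>) * Abs_fps (\<lambda>m. real ((m + ?d) choose ?d))) $ m"
    by (metis fps_nth_Abs_fps)
  also have "\<dots> = (\<Sum>i\<le>m. nth_default 0 \<delta> i * real ((m - i + ?d) choose ?d))"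
    by (simp add: fps_mult_nth atMost_atLeast0)
  also have "\<dots> = (\<Sum>i\<le>m. nth_default 0 \<delta> i * real ((m + ?d - i) choose ?d))"
    by (intro sum.cong) (auto simp: algebra_simps)
  \<comment> \<open>The range is widened to cover both \<open>i \<le> m\<close> and
    \<open>i \<le> ?d\<close>: for i > m the upper entry of the binomial is below \<open>?d\<close>,
    and for i > \<open>?d\<close> the default 0 replaces the missing entry of \<delta>.\<close>
  also have "\<dots> = (\<Sum>i\<le>m + ?d. nth_default 0 \<delta> i * real ((m + ?d - i) choose ?d))"
    by (intro sum.mono_neutral_left) (auto simp: binomial_eq_0)
  also have "\<dots> = (\<Sum>i\<le>?d. nth_default 0 \<delta> i * real ((m + ?d - i) choose ?d))"
    using len by (intro sum.mono_neutral_right) (auto simp: nth_default_beyond)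
  also have "\<dots> = (\<Sum>i\<le>?d. \<delta> ! i * real ((m + ?d - i) choose ?d))"
    using len by (intro sum.cong) (auto simp: nth_default_nth)
  finally show ?thesis .
qed

text \<open>For n < 4 one of the factors vanishes, so no lower bound on n is required.\<close>

lemma real_choose_four:
  "real (n choose 4) = real n * (real n - 1) * (real n - 2) * (real n - 3) / 24"
  by (simp add: binomial_gbinomial gbinomial_prod_rev eval_nat_numeral)

text \<open>The reflection m -> -1 - m exchanges the binomial polynomials of indices i and 4 - i.
  Palindromicity therefore makes the count even in m + 1/2; the factor 24 = 4! clears the binomial
  denominators.\<close>

lemma lattice_count_palindromic:
  fixes P :: "(real ^ 4) set"
  assumes "has_delta_vector P [1, \<delta>\<^sub>1, \<delta>\<^sub>2, \<delta>\<^sub>1, 1]"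
  shows "24 * real (lattice_count P m) =
    (2 + 2 * \<delta>\<^sub>1 + \<delta>\<^sub>2) * ((real m + 1/2)\<^sup>2)\<^sup>2
    + (43 + 7 * \<delta>\<^sub>1 - 5/2 * \<delta>\<^sub>2) * (real m + 1/2)\<^sup>2
    + (210 - 30 * \<delta>\<^sub>1 + 9 * \<delta>\<^sub>2) / 16"
proof -
  have "{..4::nat} = {0, 1, 2, 3, 4}"
    by auto
  then have "real (lattice_count P m) =
      real ((m + 4) choose 4) + \<delta>\<^sub>1 * real ((3 + m) choose 4) + \<delta>\<^sub>2 * real ((m + 2) choose 4)
      + \<delta>\<^sub>1 * real ((m + 1) choose 4) + real (m choose 4)"
    using lattice_count_delta[OF assms, of m] by simp
  then show ?thesis
    unfolding real_choose_four by (simp add: field_simps power2_eq_square)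
qed

section \<open>Sign of the leading coefficient, and real roots of biquadratics\<close>

lemma leading_coeff_pos:
  fixes A B C :: real
  assumes bound: "\<And>n::nat. real n ^ 4
      \<le> A * ((real (k * n) + 1/2)\<^sup>2)\<^sup>2 + B * (real (k * n) + 1/2)\<^sup>2 + C"
  shows "A > 0"
proof (rule ccontr)
  assume "\<not> A > 0"
  \<comment> \<open>For n \<ge> 1, kn + 1/2 \<le> (k + 1)n and 1 \<le> n^2, so without the
    nonpositive \<open>A\<close> term the bound is at most D n^2, which n^4 exceeds once n > D +
    1.\<close>
  define D where "D = \<bar>B\<bar> * (real k + 1)\<^sup>2 + \<bar>C\<bar>"
  obtain n :: nat where n: "D + 1 < n"
    using reals_Archimedean2 by blast
  have "D \<ge> 0"
    by (simp add: D_def)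
  then have n1: "real n \<ge> 1" "D < n"
    using n by auto
  have "real n ^ 4 \<le> B * (real (k * n) + 1/2)\<^sup>2 + C"
    using bound[of n] \<open>\<not> A > 0\<close> mult_nonpos_nonneg[of A "((real (k * n) + 1/2)\<^sup>2)\<^sup>2"]
    by simp
  also have "\<dots> \<le> \<bar>B\<bar> * ((real k + 1) * n)\<^sup>2 + \<bar>C\<bar> * (real n)\<^sup>2"
  proof (rule add_mono)
    have "(real (k * n) + 1/2)\<^sup>2 \<le> ((real k + 1) * n)\<^sup>2"
      using n1 by (intro power_mono) (auto simp: algebra_simps)
    then show "B * (real (k * n) + 1/2)\<^sup>2 \<le> \<bar>B\<bar> * ((real k + 1) * n)\<^sup>2"
      by (intro mult_mono) auto
    have "\<bar>C\<bar> * 1 \<le> \<bar>C\<bar> * (real n)\<^sup>2"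
      using n1 by (intro mult_left_mono) (auto simp: one_le_power)
    then show "C \<le> \<bar>C\<bar> * (real n)\<^sup>2"
      by linarith
  qed
  also have "\<dots> = D * (real n)\<^sup>2"
    unfolding D_def power_mult_distrib by (simp only: distrib_right mult.assoc)
  also have "\<dots> < (real n)\<^sup>2 * (real n)\<^sup>2"
  proof (rule mult_strict_right_mono)
    show "D < (real n)\<^sup>2"
      using n1 self_le_power[of "real n" 2] by linarith
  qed (use n1 in auto)
  finally show False
    by (simp flip: power_add)
qed

lemma complex_roots_real_iff:
  fixes A B C :: real
  assumes A: "A > 0"
  shows "(\<forall>z::complex. of_real A * (z\<^sup>2)\<^sup>2 + of_real B * z\<^sup>2 + of_real C = 0 \<longrightarrow> Im z = 0)
    \<longleftrightarrow> B \<le> 0 \<and> C \<ge> 0 \<and> 4 * A * C \<le> B\<^sup>2" (is "?real \<longleftrightarrow> ?coeffs")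
proof
  assume ?real
  define s where "s = csqrt (of_real (B\<^sup>2 - 4 * A * C))"
  have s: "s\<^sup>2 = (of_real B)\<^sup>2 - 4 * of_real A * of_real C"
    by (simp add: s_def)
  \<comment> \<open>A square root \<open>t\<close> of the discriminant yields a root
    \<open>u\<close> of the quadratic. Then \<open>csqrt u\<close> is a root of the quartic, hence
    real, and \<open>u\<close> is its square.\<close>
  have root: "\<exists>r\<ge>0. (- of_real B + t) / (2 * of_real A) = complex_of_real r"
    if t: "t\<^sup>2 = (of_real B)\<^sup>2 - 4 * of_real A * of_real C" for t :: complex
  proof -
    define u where "u = (- of_real B + t) / (2 * of_real A)"
    have tu: "t = 2 * of_real A * u + of_real B"
      using A by (simp add: u_def field_simps)
    have "4 * of_real A * (of_real A * u\<^sup>2 + of_real B * u + of_real C) = 0"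
      using t unfolding tu by (simp add: power2_eq_square algebra_simps)
    then have "of_real A * u\<^sup>2 + of_real B * u + of_real C = 0"
      using A by simp
    then have "Im (csqrt u) = 0"
      using \<open>?real\<close>[rule_format, of "csqrt u"] by simp
    then have "u = of_real ((Re (csqrt u))\<^sup>2)"
      by (metis complex_is_Real_iff of_real_Re of_real_power power2_csqrt)
    then show ?thesis
      unfolding u_def by (metis zero_le_power2)
  qed
  have A2: "2 * complex_of_real A \<noteq> 0"
    using A by simp
  obtain p where p: "p \<ge> 0" "- of_real B + s = 2 * of_real A * complex_of_real p"
    using root[OF s] A2 by (metis nonzero_eq_divide_eq mult.commute)
  obtain q where q: "q \<ge> 0" "- of_real B - s = 2 * of_real A * complex_of_real q"
    using root[of "- s"] s A2
    by (metis nonzero_eq_divide_eq mult.commute power2_minus diff_conv_add_uminus)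
  \<comment> \<open>From here on, Vieta's formulas for the nonnegative roots \<open>p\<close> and
    \<open>q\<close> give the signs of \<open>B\<close> and \<open>C\<close>.\<close>
  have "complex_of_real (- B) = complex_of_real (A * (p + q))"
    using p q by (simp add: algebra_simps) algebra
  then have B: "- B = A * (p + q)"
    by (simp only: of_real_eq_iff)
  have "s = of_real (A * (p - q))"
    using p q by (simp add: algebra_simps) algebra
  then have "complex_of_real ((A * (p - q))\<^sup>2) = complex_of_real (B\<^sup>2 - 4 * A * C)"
    using s by simp
  then have disc: "(A * (p - q))\<^sup>2 = B\<^sup>2 - 4 * A * C"
    by (simp only: of_real_eq_iff)
  have "4 * A * C = (- B)\<^sup>2 - (A * (p - q))\<^sup>2"
    using disc by simp
  also have "\<dots> = 4 * A * (A * p * q)"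
    unfolding B by algebra
  finally have "C = A * p * q"
    using A by simp
  moreover have "A * (p + q) \<ge> 0"
    using A p q by simp
  then have "B \<le> 0"
    using B by linarith
  moreover have "B\<^sup>2 - 4 * A * C \<ge> 0"
    unfolding disc[symmetric] by simp
  ultimately show ?coeffs
    using A p q by simp
next
  assume c: ?coeffs
  show ?real
  proof (intro allI impI)
    fix z :: complex
    assume "of_real A * (z\<^sup>2)\<^sup>2 + of_real B * z\<^sup>2 + of_real C = 0"
    then have eq: "of_real A * u\<^sup>2 + of_real B * u + of_real C = 0" if "u = z\<^sup>2" for u
      using that by simp
    \<comment> \<open>Completing the square: t^2 is the discriminant, which is nonnegative, so
      \<open>t\<close> and with it z^2 are real.\<close>
    define t where "t = 2 * of_real A * z\<^sup>2 + of_real B"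
    have "t\<^sup>2 = of_real (B\<^sup>2 - 4 * A * C)"
      using eq[OF refl] unfolding t_def by simp algebra
    also have "\<dots> = (of_real (sqrt (B\<^sup>2 - 4 * A * C)))\<^sup>2"
      using c by (simp flip: of_real_power)
    finally have "t \<in> \<real>"
      by (auto simp: power2_eq_iff)
    then have "(t - of_real B) / (2 * of_real A) \<in> \<real>"
      by (intro Reals_divide Reals_diff) auto
    then have "z\<^sup>2 \<in> \<real>"
      using A by (simp add: t_def)
    then obtain r where r: "z\<^sup>2 = of_real r"
      by (auto elim: Reals_cases)
    have "complex_of_real (A * r\<^sup>2 + B * r + C) = 0"
      using eq[OF r[symmetric]] by simp
    then have r0: "A * r\<^sup>2 + B * r + C = 0"
      by (simp only: of_real_eq_0_iff)
    have "r \<ge> 0"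
    proof (rule ccontr)
      assume "\<not> r \<ge> 0"
      then have "A * r\<^sup>2 > 0" "B * r \<ge> 0"
        using A c by (auto intro: mult_nonpos_nonpos)
      then show False
        using r0 c by linarith
    qed
    then have "z\<^sup>2 = (of_real (sqrt r))\<^sup>2"
      using r by (simp flip: of_real_power)
    then show "Im z = 0"
      by (auto simp: power2_eq_iff)
  qed
qed

theorem theorem3p7:
  fixes P :: "(real ^ 4) set" and \<delta>\<^sub>1 \<delta>\<^sub>2 :: real
  assumes "reflexive_polytope P"
    and "has_delta_vector P [1, \<delta>\<^sub>1, \<delta>\<^sub>2, \<delta>\<^sub>1, 1]"
  shows "real_polytope P \<longleftrightarrow>
    (\<delta>\<^sub>1 = 76 \<and> \<delta>\<^sub>2 = 230) \<or>
    (5 * \<delta>\<^sub>2 > 14 * \<delta>\<^sub>1 + 86 \<and> 10 * \<delta>\<^sub>1 \<le> 3 * \<delta>\<^sub>2 + 70 \<and>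
     17 * (\<delta>\<^sub>1 + 4 * \<delta>\<^sub>2 - 15)\<^sup>2 \<le> (17 * \<delta>\<^sub>1 + 49)\<^sup>2 + (17 * \<delta>\<^sub>2 - 94)\<^sup>2)"
proof -
  define A where "A = 2 + 2 * \<delta>\<^sub>1 + \<delta>\<^sub>2"
  define B where "B = 43 + 7 * \<delta>\<^sub>1 - 5/2 * \<delta>\<^sub>2"
  define C where "C = (210 - 30 * \<delta>\<^sub>1 + 9 * \<delta>\<^sub>2) / 16"
  have count: "24 * real (lattice_count P m) =
      A * ((real m + 1/2)\<^sup>2)\<^sup>2 + B * (real m + 1/2)\<^sup>2 + C" for m
    using lattice_count_palindromic[OF assms(2)] by (simp add: A_def B_def C_def)

  have disc: "4 * A * C \<le> B\<^sup>2 \<longleftrightarrow>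
      17 * (\<delta>\<^sub>1 + 4 * \<delta>\<^sub>2 - 15)\<^sup>2 \<le> (17 * \<delta>\<^sub>1 + 49)\<^sup>2 + (17 * \<delta>\<^sub>2 - 94)\<^sup>2"
  proof -
    \<comment> \<open>The discriminant is exactly 4/17 times the right side minus the left side of
      the stated inequality.\<close>
    have scale: "a \<le> b \<longleftrightarrow> c \<le> d" if "b - a = 4/17 * (d - c)" for a b c d :: real
      using that by (auto simp: field_simps)
    show ?thesis
      by (rule scale) (simp add: A_def B_def C_def field_simps power2_eq_square)
  qed

  have "lattice_polytope P"
    using assms(1) by (simp add: reflexive_polytope_def)
  then obtain k where "\<And>n. n ^ 4 \<le> lattice_count P (k * n)"
    using lattice_count_lower_bound[of P] by auto
  then have "real (n ^ 4) \<le> real (lattice_count P (k * n))" for n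
    using of_nat_mono by blast
  \<comment> \<open>Weakened by the factor 24 to match \<open>count\<close>; only the order of
    growth matters.\<close>
  then have "real n ^ 4 \<le> 24 * real (lattice_count P (k * n))" for n
    by (smt (verit) of_nat_power of_nat_0_le_iff)
  then have A: "A > 0"
    by (intro leading_coeff_pos[where k = k and B = B and C = C]) (simp only: count)

  define L where "L = smult (1/24)
    ([:of_real A:] * [:1/2, 1:] ^ 4 + [:of_real B:] * [:1/2, 1:] ^ 2 + [:complex_of_real C:])"
  have poly_L: "poly L z = (of_real A * ((z + 1/2)\<^sup>2)\<^sup>2 + of_real B * (z + 1/2)\<^sup>2 + of_real C) / 24"
    for z
    by (simp add: L_def add.commute flip: power_mult)
  \<comment> \<open>Positivity of \<open>A\<close> secures the exact degree demanded by the
    definition of \<open>ehrhart_poly\<close>.\<close>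
  have "degree L = 4"
    using A by (simp add: L_def eval_nat_numeral)
  moreover have "poly L (of_nat m) = of_nat (lattice_count P m)" for m
  proof -
    have "poly L (of_nat m) =
        of_real ((A * ((real m + 1/2)\<^sup>2)\<^sup>2 + B * (real m + 1/2)\<^sup>2 + C) / 24)"
      by (simp add: poly_L)
    also have "\<dots> = of_real (real (lattice_count P m))"
      unfolding count[symmetric] by simp
    finally show ?thesis
      by simp
  qed
  ultimately have "ehrhart_poly P = L"
    by (intro ehrhart_poly_eqI) auto
  then have "real_polytope P \<longleftrightarrow>
      (\<forall>z. of_real A * ((z + 1/2)\<^sup>2)\<^sup>2 + of_real B * (z + 1/2)\<^sup>2 + of_real C = 0 \<longrightarrow> Im z = 0)"
    by (simp add: real_polytope_def poly_L)
  \<comment> \<open>Translation by the real number 1/2 preserves imaginary parts.\<close>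
  also have "\<dots> \<longleftrightarrow>
      (\<forall>z::complex. of_real A * (z\<^sup>2)\<^sup>2 + of_real B * z\<^sup>2 + of_real C = 0 \<longrightarrow> Im z = 0)"
  proof (intro iffI allI impI)
    fix z :: complex
    assume "\<forall>z. of_real A * ((z + 1/2)\<^sup>2)\<^sup>2 + of_real B * (z + 1/2)\<^sup>2 + of_real C = 0 \<longrightarrow> Im z = 0"
      and "of_real A * (z\<^sup>2)\<^sup>2 + of_real B * z\<^sup>2 + of_real C = 0"
    then have "Im (z - 1/2) = 0"
      by (metis diff_add_cancel)
    then show "Im z = 0"
      by simp
  next
    fix z :: complex
    assume "\<forall>z::complex. of_real A * (z\<^sup>2)\<^sup>2 + of_real B * z\<^sup>2 + of_real C = 0 \<longrightarrow> Im z = 0"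
      and "of_real A * ((z + 1/2)\<^sup>2)\<^sup>2 + of_real B * (z + 1/2)\<^sup>2 + of_real C = 0"
    then have "Im (z + 1/2) = 0"
      by blast
    then show "Im z = 0"
      by simp
  qed
  also have "\<dots> \<longleftrightarrow> B \<le> 0 \<and> C \<ge> 0 \<and> 4 * A * C \<le> B\<^sup>2"
    by (rule complex_roots_real_iff[OF A])
  \<comment> \<open>If B = 0, the discriminant condition reads 4AC \<le> 0, which with A > 0 and C
    \<ge> 0 leaves only C = 0.\<close>
  also have "\<dots> \<longleftrightarrow> (B = 0 \<and> C = 0) \<or> (B < 0 \<and> C \<ge> 0 \<and> 4 * A * C \<le> B\<^sup>2)"
    using A by (auto simp: mult_le_0_iff)
  also have "B = 0 \<and> C = 0 \<longleftrightarrow> \<delta>\<^sub>1 = 76 \<and> \<delta>\<^sub>2 = 230"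
    by (auto simp: B_def C_def)
  also have "B < 0 \<longleftrightarrow> 5 * \<delta>\<^sub>2 > 14 * \<delta>\<^sub>1 + 86"
    by (auto simp: B_def)
  also have "C \<ge> 0 \<longleftrightarrow> 10 * \<delta>\<^sub>1 \<le> 3 * \<delta>\<^sub>2 + 70"
    by (auto simp: C_def)
  also note disc
  finally show ?thesis .
qed

end
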